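(* Let $\Sigma$ be a finite alphabet. For any set $\mathcal S$ of labelled transition systems over $\Sigma$, the following are equivalent: (1) there exists a $\nu$HML formula $\Delta$ with $[\![\Delta]\!]=\mathcal S$; (2) there exists a finite NAA $S$ with $[\![S]\!]=\mathcal S$; (3) there exists a finite DMTS $S$ with $[\![S]\!]=\mathcal S$. Furthermore, statements (2) and (3) remain equivalent if the finiteness requirements on the NAA and DMTS are dropped.
   Context: A labelled transition system (LTS) over $\Sigma$ is $(S,s^0,\to)$ with $s^0\in S$ and $\to\subseteq S\times\Sigma\times S$ image-finite (for each $s,a$ the set $\{s'\mid s\xrightarrow{a}s'\}$ is finite). $\nu$HML: HML formulae over a set $X$ of variables are given by $\phi::=\mathbf{tt}\mid\mathbf{ff}\mid x\mid\phi\wedge\phi\mid\phi\vee\phi\mid\langle a\rangle\phi\mid[a]\phi$ ($x\in X$, $a\in\Sigma$). Given an LTS $(S,s^0,\to)$ and an assignment $\sigma:X\to 2^S$, $[\![\mathbf{tt}]\!]\sigma=S$, $[\![\mathbf{ff}]\!]\sigma=\emptyset$, $[\![x]\!]\sigma=\sigma(x)$, $\wedge,\vee$ are intersection and union, $[\![\langle a\rangle\phi]\!]\sigma=\{s\mid\exists s\xrightarrow{a}s': s'\in[\![\phi]\!]\sigma\}$, $[\![[a]\phi]\!]\sigma=\{s\mid\forall s\xrightarrow{a}s': s'\in[\![\phi]\!]\sigma\}$. For a declaration $\Delta:X\to\mathrm{HML}(X)$, $[\![\Delta]\!]$ is the greatest assignment $\sigma$ (pointwise inclusion) with $\sigma(x)\subseteq[\![\Delta(x)]\!]\sigma$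 for all $x$. A $\nu$HML formula is $(X,X^0,\Delta)$ with $X^0\subseteq X$ finite sets and $\Delta$ a declaration; an LTS implements it if $s^0\in[\![\Delta]\!](x^0)$ for some $x^0\in X^0$; $[\![\Delta]\!]$ also denotes the set of its implementations. DMTS: $(S,S^0,\dashrightarrow,\longrightarrow)$ with $S^0\subseteq S$ finite, image-finite may relation $\dashrightarrow\subseteq S\times\Sigma\times S$, and disjunctive must relation $\longrightarrow\subseteq S\times 2^{\Sigma\times S}$ such that $s\longrightarrow N$ and $(a,t)\in N$ imply $s\overset{a}{\dashrightarrow}t$. A relation $R\subseteq S_1\times S_2$ is a DMTS modal refinement if for all $(s_1,s_2)\in R$: for all $s_1\overset{a}{\dashrightarrow}t_1$ there is $s_2\overset{a}{\dashrightarrow}t_2$ with $(t_1,t_2)\in R$; and for all $s_2\longrightarrow N_2$ there is $s_1\longrightarrow N_1$ such that each $(a,t_1)\in N_1$ has some $(a,t_2)\in N_2$ with $(t_1,t_2)\in R$. An LTS $(I,i^0,\to)$ is viewed as the DMTS $(I,\{i^0\},\to,\{(s,\{(a,t)\})\mid s\xrightarrow{a}t\})$. NAA: $(S,S^0,\mathrm{Tran})$ with $S^0\subseteq S$ finite and $\mathrm{Tran}:S\to 2^{\mathcal P_{\mathrm{fin}}(\Sigma\times S)}$. NAA modal refinement $R$: for $(s_1,s_2)\in R$ and $M_1\in\mathrm{Tran}_1(s_1)$ there is $M_2\in\mathrm{Tran}_2(s_2)$ such that every $(a,t_1)\in M_1$ has $(a,t_2)\in M_2$ with $(t_1,t_2)\in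 R$ and every $(a,t_2)\in M_2$ has $(a,t_1)\in M_1$ with $(t_1,t_2)\in R$. An LTS $(I,i^0,\to)$ is viewed as the NAA $(I,\{i^0\},\mathrm{Tran})$ with $\mathrm{Tran}(s)=\{\{(a,t)\mid s\xrightarrow{a}t\}\}$. In both DMTS and NAA a refinement is initialised if each initial state of the left side is related to some initial state of the right side; $S_1\le_m S_2$ means an initialised modal refinement exists; $[\![S]\!]$ is the set of LTS $I$ with $I\le_m S$.
   Formalization: The final clause is proved for NAA in which each Tran(s) is a finite set (automatic for finite NAA); without this it fails: with Tran(s0)={{(a,t_n)} | n}, t_n allowing exactly n steps, the NAA implements all finite chains but not the loop, which no DMTS can do. *)

theory Defs
  imports "HOL-Library.Infinite_Typeclass"
begin

text \<open>The alphabet \<open>\<Sigma>\<close> is the type \<open>'a\<close>, of class \<open>finite\<close> in the theorem. State sets and sets of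
  variables are explicit carriers, so that infinite ambient types contain the finite structures.\<close>

section \<open>Labelled transition systems\<close>

record ('a, 's) lts =
  lts_states :: "'s set"
  lts_init :: 's
  lts_trans :: "('s \<times> 'a \<times> 's) set"

definition image_finite :: "'s set \<Rightarrow> ('s \<times> 'a \<times> 's) set \<Rightarrow> bool" where
  "image_finite S T \<longleftrightarrow> (\<forall>s\<in>S. \<forall>a. finite {t. (s, a, t) \<in> T})"

definition is_lts :: "('a, 's) lts \<Rightarrow> bool" where
  "is_lts L \<longleftrightarrow> lts_init L \<in> lts_states L
     \<and> lts_trans L \<subseteq> lts_states L \<times> UNIV \<times> lts_states L
     \<and> image_finite (lts_states L) (lts_trans L)"

section \<open>The modal nu-calculus\<close>

datatype ('a, vars: 'x) hml =
    TT
  | FF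
  | Var 'x
  | And "('a, 'x) hml" "('a, 'x) hml"
  | Or "('a, 'x) hml" "('a, 'x) hml"
  | Dia 'a "('a, 'x) hml"
  | Box 'a "('a, 'x) hml"

primrec hml_sem :: "('a, 's) lts \<Rightarrow> ('a, 'x) hml \<Rightarrow> ('x \<Rightarrow> 's set) \<Rightarrow> 's set" where
  "hml_sem L TT \<sigma> = lts_states L"
| "hml_sem L FF \<sigma> = {}"
| "hml_sem L (Var x) \<sigma> = \<sigma> x"
| "hml_sem L (And \<phi> \<psi>) \<sigma> = hml_sem L \<phi> \<sigma> \<inter> hml_sem L \<psi> \<sigma>"
| "hml_sem L (Or \<phi> \<psi>) \<sigma> = hml_sem L \<phi> \<sigma> \<union> hml_sem L \<psi> \<sigma>"
| "hml_sem L (Dia a \<phi>) \<sigma> =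
     {s \<in> lts_states L. \<exists>s'. (s, a, s') \<in> lts_trans L \<and> s' \<in> hml_sem L \<phi> \<sigma>}"
| "hml_sem L (Box a \<phi>) \<sigma> =
     {s \<in> lts_states L. \<forall>s'. (s, a, s') \<in> lts_trans L \<longrightarrow> s' \<in> hml_sem L \<phi> \<sigma>}"

record ('a, 'x) nuhml =
  nu_vars :: "'x set"
  nu_init :: "'x set"
  nu_decl :: "'x \<Rightarrow> ('a, 'x) hml"

definition is_nuhml :: "('a, 'x) nuhml \<Rightarrow> bool" where
  "is_nuhml F \<longleftrightarrow> finite (nu_vars F) \<and> nu_init F \<subseteq> nu_vars F
     \<and> (\<forall>x\<in>nu_vars F. vars (nu_decl F x) \<subseteq> nu_vars F)"

text \<open>An assignment \<open>X \<rightarrow> 2\<^sup>S\<close> is a total function that is empty outside \<open>X\<close>; the order on functions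
  is then pointwise inclusion on \<open>X\<close>.\<close>

definition nu_assignment :: "('a, 's) lts \<Rightarrow> ('a, 'x) nuhml \<Rightarrow> ('x \<Rightarrow> 's set) \<Rightarrow> bool" where
  "nu_assignment L F \<sigma> \<longleftrightarrow>
     (\<forall>x\<in>nu_vars F. \<sigma> x \<subseteq> lts_states L) \<and> (\<forall>x. x \<notin> nu_vars F \<longrightarrow> \<sigma> x = {})"

definition nu_postfixed :: "('a, 's) lts \<Rightarrow> ('a, 'x) nuhml \<Rightarrow> ('x \<Rightarrow> 's set) \<Rightarrow> bool" where
  "nu_postfixed L F \<sigma> \<longleftrightarrow>
     nu_assignment L F \<sigma> \<and> (\<forall>x\<in>nu_vars F. \<sigma> x \<subseteq> hml_sem L (nu_decl F x) \<sigma>)"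

definition nu_sem :: "('a, 's) lts \<Rightarrow> ('a, 'x) nuhml \<Rightarrow> 'x \<Rightarrow> 's set" where
  "nu_sem L F = (GREATEST \<sigma>. nu_postfixed L F \<sigma>)"

lemma hml_sem_mono: "\<sigma> \<le> \<tau> \<Longrightarrow> hml_sem L \<phi> \<sigma> \<subseteq> hml_sem L \<phi> \<tau>"
  by (induction \<phi>) (auto simp: le_fun_def)

text \<open>The greatest assignment exists, so the description operator in the definition is harmless.\<close>

lemma nu_sem_greatest:
  shows "nu_postfixed L F (nu_sem L F)"
    and "nu_postfixed L F \<sigma> \<Longrightarrow> \<sigma> \<le> nu_sem L F"
proof -
  let ?P = "nu_postfixed L F"
  let ?m = "\<lambda>x. \<Union>\<sigma>\<in>Collect ?P. \<sigma> x"
  have up: "\<tau> \<le> ?m" if "?P \<tau>" for \<tau>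
    using that by (auto simp: le_fun_def)
  have m: "?P ?m"
  proof (rule nu_postfixed_def[THEN iffD2], intro conjI ballI)
    show "nu_assignment L F ?m"
      unfolding nu_postfixed_def nu_assignment_def by blast
  next
    fix x assume x: "x \<in> nu_vars F"
    show "?m x \<subseteq> hml_sem L (nu_decl F x) ?m"
    proof (rule UN_least)
      fix \<tau> assume \<tau>: "\<tau> \<in> Collect ?P"
      then have "\<tau> x \<subseteq> hml_sem L (nu_decl F x) \<tau>"
        using x by (auto simp: nu_postfixed_def)
      also have "\<dots> \<subseteq> hml_sem L (nu_decl F x) ?m"
        using \<tau> by (intro hml_sem_mono up) simp
      finally show "\<tau> x \<subseteq> hml_sem L (nu_decl F x) ?m" .
    qed
  qed
  have eq: "nu_sem L F = ?m"
    unfolding nu_sem_def by (rule Greatest_equality) (use m up in auto)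
  show "?P (nu_sem L F)"
    unfolding eq by (rule m)
  show "\<sigma> \<le> nu_sem L F" if "?P \<sigma>"
    unfolding eq using that by (rule up)
qed

definition nuhml_impls :: "('a, 'x) nuhml \<Rightarrow> ('a, 's) lts set" where
  "nuhml_impls F = {L. is_lts L \<and> (\<exists>x0\<in>nu_init F. lts_init L \<in> nu_sem L F x0)}"

section \<open>Disjunctive modal transition systems\<close>

record ('a, 'q) dmts =
  dmts_states :: "'q set"
  dmts_init :: "'q set"
  dmts_may :: "('q \<times> 'a \<times> 'q) set"
  dmts_must :: "('q \<times> ('a \<times> 'q) set) set"

definition is_dmts :: "('a, 'q) dmts \<Rightarrow> bool" where
  "is_dmts D \<longleftrightarrow> dmts_init D \<subseteq> dmts_states D \<and> finite (dmts_init D)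
     \<and> dmts_may D \<subseteq> dmts_states D \<times> UNIV \<times> dmts_states D
     \<and> image_finite (dmts_states D) (dmts_may D)
     \<and> dmts_must D \<subseteq> dmts_states D \<times> Pow (UNIV \<times> dmts_states D)
     \<and> (\<forall>s N a t. (s, N) \<in> dmts_must D \<and> (a, t) \<in> N \<longrightarrow> (s, a, t) \<in> dmts_may D)"

definition dmts_refinement ::
  "('a, 'p) dmts \<Rightarrow> ('a, 'q) dmts \<Rightarrow> ('p \<times> 'q) set \<Rightarrow> bool" where
  "dmts_refinement D1 D2 R \<longleftrightarrow> R \<subseteq> dmts_states D1 \<times> dmts_states D2
     \<and> (\<forall>(s1, s2)\<in>R.
          (\<forall>a t1. (s1, a, t1) \<in> dmts_may D1 \<longrightarrow>
             (\<exists>t2. (s2, a, t2) \<in> dmts_may D2 \<and> (t1, t2) \<in> R))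
        \<and> (\<forall>N2. (s2, N2) \<in> dmts_must D2 \<longrightarrow>
             (\<exists>N1. (s1, N1) \<in> dmts_must D1
                \<and> (\<forall>(a, t1)\<in>N1. \<exists>t2. (a, t2) \<in> N2 \<and> (t1, t2) \<in> R))))"

definition dmts_refines :: "('a, 'p) dmts \<Rightarrow> ('a, 'q) dmts \<Rightarrow> bool" where
  "dmts_refines D1 D2 \<longleftrightarrow>
     (\<exists>R. dmts_refinement D1 D2 R \<and> (\<forall>s1\<in>dmts_init D1. \<exists>s2\<in>dmts_init D2. (s1, s2) \<in> R))"

definition dmts_of_lts :: "('a, 's) lts \<Rightarrow> ('a, 's) dmts" where
  "dmts_of_lts L = \<lparr>dmts_states = lts_states L, dmts_init = {lts_init L},
     dmts_may = lts_trans L, dmts_must = {(s, {(a, t)}) | s a t. (s, a, t) \<in> lts_trans L}\<rparr>"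

definition dmts_impls :: "('a, 'q) dmts \<Rightarrow> ('a, 's) lts set" where
  "dmts_impls D = {L. is_lts L \<and> dmts_refines (dmts_of_lts L) D}"

section \<open>Nondeterministic acceptance automata\<close>

record ('a, 'q) naa =
  naa_states :: "'q set"
  naa_init :: "'q set"
  naa_tran :: "'q \<Rightarrow> ('a \<times> 'q) set set"

definition is_naa :: "('a, 'q) naa \<Rightarrow> bool" where
  "is_naa A \<longleftrightarrow> naa_init A \<subseteq> naa_states A \<and> finite (naa_init A)
     \<and> (\<forall>s\<in>naa_states A. naa_tran A s \<subseteq> Fpow (UNIV \<times> naa_states A))"

definition naa_refinement ::
  "('a, 'p) naa \<Rightarrow> ('a, 'q) naa \<Rightarrow> ('p \<times> 'q) set \<Rightarrow> bool" where
  "naa_refinement A1 A2 R \<longleftrightarrow> R \<subseteq> naa_states A1 \<times> naa_states A2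
     \<and> (\<forall>(s1, s2)\<in>R. \<forall>M1\<in>naa_tran A1 s1. \<exists>M2\<in>naa_tran A2 s2.
          (\<forall>(a, t1)\<in>M1. \<exists>t2. (a, t2) \<in> M2 \<and> (t1, t2) \<in> R)
        \<and> (\<forall>(a, t2)\<in>M2. \<exists>t1. (a, t1) \<in> M1 \<and> (t1, t2) \<in> R))"

definition naa_refines :: "('a, 'p) naa \<Rightarrow> ('a, 'q) naa \<Rightarrow> bool" where
  "naa_refines A1 A2 \<longleftrightarrow>
     (\<exists>R. naa_refinement A1 A2 R \<and> (\<forall>s1\<in>naa_init A1. \<exists>s2\<in>naa_init A2. (s1, s2) \<in> R))"

definition naa_of_lts :: "('a, 's) lts \<Rightarrow> ('a, 's) naa" where
  "naa_of_lts L = \<lparr>naa_states = lts_states L, naa_init = {lts_init L},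
     naa_tran = (\<lambda>s. {{(a, t). (s, a, t) \<in> lts_trans L}})\<rparr>"

definition naa_impls :: "('a, 'q) naa \<Rightarrow> ('a, 's) lts set" where
  "naa_impls A = {L. is_lts L \<and> naa_refines (naa_of_lts L) A}"

text \<open>Counterpart for acceptance automata of image-finiteness; it holds for every finite automaton
  over a finite alphabet.\<close>

definition naa_locally_finite :: "('a, 'q) naa \<Rightarrow> bool" where
  "naa_locally_finite A \<longleftrightarrow> (\<forall>s\<in>naa_states A. finite (naa_tran A s))"

lemma finite_naa_locally_finite:
  fixes A :: "('a::finite, 'q) naa"
  assumes "is_naa A" "finite (naa_states A)"
  shows "naa_locally_finite A"
  unfolding naa_locally_finite_def
proof
  fix s assume "s \<in> naa_states A"
  then have "naa_tran A s \<subseteq> Pow (UNIV \<times> naa_states A)"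
    using assms(1) by (auto simp: is_naa_def Fpow_def)
  moreover have "finite (Pow ((UNIV :: 'a set) \<times> naa_states A))"
    using assms(2) by simp
  ultimately show "finite (naa_tran A s)"
    by (rule finite_subset)
qed

subsection \<open>Infinite automata that are not locally finite\<close>

text \<open>The implementations of the following automaton are, up to bisimilarity, the finite chains with
  at least one transition. A system with finitely many initial states and an image-finite may
  relation that admits all of them also admits the infinite chain. So without local finiteness, an
  infinite automaton need not have an equivalent disjunctive modal transition system.\<close>

definition chains_naa :: "(unit, nat) naa" where
  "chains_naa = \<lparr>naa_states = UNIV, naa_init = {0}, naa_tran = (\<lambda>s. case s of
       0 \<Rightarrow> range (\<lambda>n. {((), Suc n)})
     | Suc 0 \<Rightarrow> {{}}
     | Suc (Suc k) \<Rightarrow> {{((), Suc k)}})\<rparr>"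

definition chain :: "nat \<Rightarrow> (unit, nat) lts" where
  "chain n = \<lparr>lts_states = UNIV, lts_init = n, lts_trans = {(Suc k, (), k) | k. True}\<rparr>"

definition loop :: "(unit, nat) lts" where
  "loop = \<lparr>lts_states = {0}, lts_init = 0, lts_trans = {(0, (), 0)}\<rparr>"

lemma is_naa_chains_naa: "is_naa chains_naa"
  by (auto simp: is_naa_def chains_naa_def Fpow_def split: nat.splits)

lemma is_lts_chain: "is_lts (chain n)"
proof -
  have "finite {t. \<exists>k. s = Suc k \<and> t = k}" for s :: nat
    by (rule finite_subset[of _ "{..s}"]) auto
  then show ?thesis
    by (auto simp: is_lts_def chain_def image_finite_def)
qed

lemma is_lts_loop: "is_lts loop"
  by (auto simp: is_lts_def loop_def image_finite_def)

lemma chain_in_chains_naa: "chain (Suc n) \<in> naa_impls chains_naa"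
proof -
  let ?R = "insert (Suc n, 0) {(k, Suc k) | k. True}"
  have "naa_refinement (naa_of_lts (chain (Suc n))) chains_naa ?R"
    by (auto simp: naa_refinement_def naa_of_lts_def chain_def chains_naa_def split: nat.splits)
  then show ?thesis
    unfolding naa_impls_def naa_refines_def
    using is_lts_chain by (auto simp: naa_of_lts_def chain_def chains_naa_def)
qed

lemma loop_notin_chains_naa: "loop \<notin> naa_impls chains_naa"
proof
  assume "loop \<in> naa_impls chains_naa"
  then obtain R where R: "naa_refinement (naa_of_lts loop) chains_naa R" and init: "(0, 0) \<in> R"
    by (auto simp: naa_impls_def naa_refines_def naa_of_lts_def loop_def chains_naa_def)
  have step: "\<exists>M\<in>naa_tran chains_naa s. \<exists>t. ((), t) \<in> M \<and> (0, t) \<in> R" if "(0, s) \<in> R" for s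
  proof -
    have "\<forall>M1\<in>naa_tran (naa_of_lts loop) 0. \<exists>M2\<in>naa_tran chains_naa s.
        (\<forall>(a, t1)\<in>M1. \<exists>t2. (a, t2) \<in> M2 \<and> (t1, t2) \<in> R)
      \<and> (\<forall>(a, t2)\<in>M2. \<exists>t1. (a, t1) \<in> M1 \<and> (t1, t2) \<in> R)"
      using R[unfolded naa_refinement_def, THEN conjunct2, THEN bspec, OF that]
      by (simp only: prod.case)
    moreover have "naa_tran (naa_of_lts loop) 0 = {{((), 0)}}"
      by (auto simp: naa_of_lts_def loop_def)
    ultimately show ?thesis
      by auto
  qed
  have "(0, Suc n) \<notin> R" for n
  proof (induction n)
    case 0
    then show ?case using step[of "Suc 0"] by (auto simp: chains_naa_def)
  next
    case (Suc n)
    then show ?case using step[of "Suc (Suc n)"] by (auto simp: chains_naa_def)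
  qed
  then show False
    using step[OF init] by (auto simp: chains_naa_def)
qed

lemma infinite_pigeonhole:
  assumes "infinite (I :: nat set)" "finite T" "\<And>n. n \<in> I \<Longrightarrow> \<exists>t\<in>T. P t n"
  shows "\<exists>t\<in>T. infinite {n. P t n}"
proof (rule ccontr)
  assume "\<not> ?thesis"
  then have "finite (\<Union>t\<in>T. {n. P t n})"
    using assms(2) by auto
  moreover have "I \<subseteq> (\<Union>t\<in>T. {n. P t n})"
    using assms(3) by auto
  ultimately show False
    using assms(1) finite_subset by blast
qed

lemma loop_in_dmts_impls:
  fixes D :: "(unit, 'q) dmts"
  assumes D: "is_dmts D" and chains: "\<And>n. chain (Suc n) \<in> dmts_impls D"
  shows "loop \<in> dmts_impls D"
proof -
  define P where "P d n \<longleftrightarrow> (\<exists>R. dmts_refinement (dmts_of_lts (chain 0)) D R \<and> (n, d) \<in> R)" for d n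
  have ref0: "dmts_refinement (dmts_of_lts (chain n)) D R
      = dmts_refinement (dmts_of_lts (chain 0)) D R" for n R
    by (simp add: dmts_refinement_def dmts_of_lts_def chain_def)
  have P_state: "d \<in> dmts_states D" if "P d n" for d n
    using that by (auto simp: P_def dmts_refinement_def)
  have P_may: "\<exists>t. (d, (), t) \<in> dmts_may D \<and> P t n" if "P d (Suc n)" for d n
  proof -
    from that obtain R where R: "dmts_refinement (dmts_of_lts (chain 0)) D R" "(Suc n, d) \<in> R"
      by (auto simp: P_def)
    moreover have "(Suc n, (), n) \<in> dmts_may (dmts_of_lts (chain 0))"
      by (auto simp: dmts_of_lts_def chain_def)
    ultimately have "\<exists>t. (d, (), t) \<in> dmts_may D \<and> (n, t) \<in> R"
      unfolding dmts_refinement_def by blast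
    then show ?thesis using R(1) by (auto simp: P_def)
  qed
  have P_must: "\<exists>t. ((), t) \<in> N \<and> P t n" if P: "P d (Suc n)" and N: "(d, N) \<in> dmts_must D" for d n N
  proof -
    from P obtain R where R: "dmts_refinement (dmts_of_lts (chain 0)) D R" "(Suc n, d) \<in> R"
      by (auto simp: P_def)
    then obtain N1 where "(Suc n, N1) \<in> dmts_must (dmts_of_lts (chain 0))"
      "\<forall>(a, t1)\<in>N1. \<exists>t2. (a, t2) \<in> N \<and> (t1, t2) \<in> R"
      using N unfolding dmts_refinement_def by blast
    then show ?thesis
      using R(1) by (auto simp: P_def dmts_of_lts_def chain_def)
  qed
  have fin: "finite {t. (d, (), t) \<in> dmts_may D}" if "d \<in> dmts_states D" for d
    using D that by (auto simp: is_dmts_def image_finite_def)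
  have inf_pred: "infinite {n. P d (Suc n)}" if "infinite {n. P d n}" for d
  proof
    assume "finite {n. P d (Suc n)}"
    then have "finite (insert 0 (Suc ` {n. P d (Suc n)}))" by simp
    moreover have "{n. P d n} \<subseteq> insert 0 (Suc ` {n. P d (Suc n)})"
    proof
      fix n assume "n \<in> {n. P d n}"
      then show "n \<in> insert 0 (Suc ` {n. P d (Suc n)})" by (cases n) auto
    qed
    ultimately show False using that finite_subset by blast
  qed
  have inf_state: "d \<in> dmts_states D" if "infinite {n. P d n}" for d
    using that P_state not_finite_existsD by blast
  define R where "R = {(0 :: nat, d) | d. infinite {n. P d n}}"
  have "dmts_refinement (dmts_of_lts loop) D R"
  proof -
    have may: "\<exists>t. (d, (), t) \<in> dmts_may D \<and> infinite {n. P t n}" if d: "infinite {n. P d n}" for d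
      using infinite_pigeonhole[OF inf_pred[OF d] fin[OF inf_state[OF d]], of P] P_may by auto
    have must: "\<exists>t. ((), t) \<in> N \<and> infinite {n. P t n}"
      if d: "infinite {n. P d n}" and N: "(d, N) \<in> dmts_must D" for d N
    proof -
      have "{t. ((), t) \<in> N} \<subseteq> {t. (d, (), t) \<in> dmts_may D}"
        using D N by (auto simp: is_dmts_def)
      then have "finite {t. ((), t) \<in> N}"
        using fin[OF inf_state[OF d]] finite_subset by blast
      from infinite_pigeonhole[OF inf_pred[OF d] this, of P] show ?thesis
        using P_must[OF _ N] by auto
    qed
    show ?thesis
      unfolding dmts_refinement_def
      using may must inf_state by (auto simp: R_def dmts_of_lts_def loop_def)
  qed
  moreover have "\<exists>d\<in>dmts_init D. (0, d) \<in> R"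
  proof -
    have ex: "\<exists>d\<in>dmts_init D. P d n" if "n \<in> range Suc" for n
    proof -
      from that obtain k where k: "n = Suc k" by blast
      have "dmts_init (dmts_of_lts (chain n)) = {n}"
        by (simp add: dmts_of_lts_def chain_def)
      then obtain R' d where "dmts_refinement (dmts_of_lts (chain n)) D R'"
        "d \<in> dmts_init D" "(n, d) \<in> R'"
        using chains[of k] unfolding dmts_impls_def dmts_refines_def k by auto
      then show ?thesis
        unfolding ref0[of n] P_def by blast
    qed
    have "infinite (range Suc)"
      by (simp add: finite_image_iff)
    moreover have "finite (dmts_init D)"
      using D by (simp add: is_dmts_def)
    ultimately have "\<exists>d\<in>dmts_init D. infinite {n. P d n}"
      using ex by (rule infinite_pigeonhole)
    then show ?thesis by (auto simp: R_def)
  qed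
  ultimately show ?thesis
    unfolding dmts_impls_def dmts_refines_def
    using is_lts_loop by (auto simp: dmts_of_lts_def loop_def)
qed

theorem chains_naa_not_dmts:
  "\<nexists>D :: (unit, 'q) dmts.
     is_dmts D \<and> dmts_impls D = (naa_impls chains_naa :: (unit, nat) lts set)"
proof
  assume "\<exists>D :: (unit, 'q) dmts.
     is_dmts D \<and> dmts_impls D = (naa_impls chains_naa :: (unit, nat) lts set)"
  then obtain D :: "(unit, 'q) dmts" where D: "is_dmts D"
    and eq: "dmts_impls D = (naa_impls chains_naa :: (unit, nat) lts set)"
    by blast
  have "loop \<in> dmts_impls D"
    by (rule loop_in_dmts_impls[OF D]) (simp only: eq chain_in_chains_naa)
  then show False
    using loop_notin_chains_naa by (simp only: eq)
qed

end

theory Submission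
  imports Defs "HOL-Algebra.Free_Abelian_Groups"
begin

text \<open>A disjunctive modal transition system becomes an acceptance automaton on the same states, whose
  acceptance sets are the sets of may transitions meeting every must. Conversely, the acceptance
  sets themselves serve as states; they are finite sets, so they fit into the given infinite state
  type even when the automaton is infinite. The declaration of a state in the nu-calculus is the
  disjunction of the characteristic formulas of its acceptance sets. For the way back no normal form
  is needed: the Hintikka sets of subformulas are the states, and their modal members determine the
  acceptance sets.\<close>

section \<open>Implementation relations, specialised to transition systems on the left\<close>

text \<open>A transition system has a single acceptance set at each state, so the quantifier over
  \<open>M1\<close> disappears and one \<open>M\<close> has to match the transitions of
  \<open>i\<close> in both directions.\<close>

lemma naa_impls_iff:
  "L \<in> naa_impls A \<longleftrightarrow> is_lts L \<and>
    (\<exists>R. R \<subseteq> lts_states L \<times> naa_states A \<and> (\<exists>s\<in>naa_init A. (lts_init L, s) \<in> R)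
      \<and> (\<forall>i s. (i, s) \<in> R \<longrightarrow> (\<exists>M\<in>naa_tran A s.
            (\<forall>a j. (i, a, j) \<in> lts_trans L \<longrightarrow> (\<exists>t. (a, t) \<in> M \<and> (j, t) \<in> R))
          \<and> (\<forall>a t. (a, t) \<in> M \<longrightarrow> (\<exists>j. (i, a, j) \<in> lts_trans L \<and> (j, t) \<in> R)))))"
  by (simp add: naa_impls_def naa_refines_def naa_refinement_def naa_of_lts_def
      Ball_def split_paired_All conj_ac)

text \<open>Every must of a transition system is a singleton, so meeting a must \<open>N\<close>
  amounts to exhibiting one transition of \<open>i\<close> that leads into \<open>N\<close>.\<close>

lemma dmts_impls_iff:
  "L \<in> dmts_impls D \<longleftrightarrow> is_lts L \<and>
    (\<exists>R. R \<subseteq> lts_states L \<times> dmts_states D \<and> (\<exists>s\<in>dmts_init D. (lts_init L, s) \<in> R)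
      \<and> (\<forall>i s. (i, s) \<in> R \<longrightarrow>
            (\<forall>a j. (i, a, j) \<in> lts_trans L \<longrightarrow> (\<exists>t. (s, a, t) \<in> dmts_may D \<and> (j, t) \<in> R))
          \<and> (\<forall>N. (s, N) \<in> dmts_must D \<longrightarrow>
               (\<exists>a j t. (i, a, j) \<in> lts_trans L \<and> (a, t) \<in> N \<and> (j, t) \<in> R))))"
proof -
  have *: "(\<exists>N1. (\<exists>a t. N1 = {(a, t)} \<and> (i, a, t) \<in> T)
        \<and> (\<forall>(a, t1)\<in>N1. \<exists>t2. (a, t2) \<in> N \<and> (t1, t2) \<in> R))
      \<longleftrightarrow> (\<exists>a j t. (i, a, j) \<in> T \<and> (a, t) \<in> N \<and> (j, t) \<in> R)" for i T N R
    by auto blast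
  have "dmts_refinement (dmts_of_lts L) D R \<longleftrightarrow> R \<subseteq> lts_states L \<times> dmts_states D
      \<and> (\<forall>i s. (i, s) \<in> R \<longrightarrow>
            (\<forall>a j. (i, a, j) \<in> lts_trans L \<longrightarrow> (\<exists>t. (s, a, t) \<in> dmts_may D \<and> (j, t) \<in> R))
          \<and> (\<forall>N. (s, N) \<in> dmts_must D \<longrightarrow>
               (\<exists>a j t. (i, a, j) \<in> lts_trans L \<and> (a, t) \<in> N \<and> (j, t) \<in> R)))" for R
    by (simp add: dmts_refinement_def dmts_of_lts_def *) blast
  then show ?thesis
    by (auto simp: dmts_impls_def dmts_refines_def dmts_of_lts_def)
qed

section \<open>From disjunctive modal transition systems to acceptance automata\<close>

definition naa_of_dmts :: "('a, 'q) dmts \<Rightarrow> ('a, 'q) naa" where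
  "naa_of_dmts D = \<lparr>naa_states = dmts_states D, naa_init = dmts_init D,
     naa_tran = (\<lambda>s. {M. M \<subseteq> {(a, t). (s, a, t) \<in> dmts_may D}
       \<and> (\<forall>N. (s, N) \<in> dmts_must D \<longrightarrow> N \<inter> M \<noteq> {})})\<rparr>"

text \<open>Image-finiteness bounds the successors for one label at a time; the finite alphabet
  turns this into a bound on all of them.\<close>

lemma finite_dmts_may:
  fixes D :: "('a::finite, 'q) dmts"
  assumes "is_dmts D" "s \<in> dmts_states D"
  shows "finite {(a, t). (s, a, t) \<in> dmts_may D}"
proof -
  have "{(a, t). (s, a, t) \<in> dmts_may D} = (SIGMA a:UNIV. {t. (s, a, t) \<in> dmts_may D})"
    by auto
  then show ?thesis
    using assms by (auto simp: is_dmts_def image_finite_def)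
qed

lemma is_naa_naa_of_dmts:
  fixes D :: "('a::finite, 'q) dmts"
  assumes "is_dmts D"
  shows "is_naa (naa_of_dmts D)"
proof -
  have "M \<in> Fpow (UNIV \<times> dmts_states D)"
    if "s \<in> dmts_states D" "M \<subseteq> {(a, t). (s, a, t) \<in> dmts_may D}" for s M
    using that assms finite_subset[OF that(2) finite_dmts_may[OF assms that(1)]]
    by (auto simp: Fpow_def is_dmts_def)
  then show ?thesis
    using assms by (auto simp: is_naa_def naa_of_dmts_def is_dmts_def)
qed

lemma naa_locally_finite_naa_of_dmts:
  fixes D :: "('a::finite, 'q) dmts"
  assumes "is_dmts D"
  shows "naa_locally_finite (naa_of_dmts D)"
  unfolding naa_locally_finite_def
proof
  fix s assume "s \<in> naa_states (naa_of_dmts D)"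
  then have "finite (Pow {(a, t). (s, a, t) \<in> dmts_may D})"
    using finite_dmts_may[OF assms] by (simp add: naa_of_dmts_def)
  then show "finite (naa_tran (naa_of_dmts D) s)"
    by (rule rev_finite_subset) (auto simp: naa_of_dmts_def)
qed

text \<open>Carriers and initial states coincide, and for any fixed \<open>R\<close> the local
  conditions at a pair \<open>(i, s)\<close> are equivalent. The same relation therefore witnesses
  both kinds of refinement.\<close>

lemma naa_impls_naa_of_dmts:
  fixes D :: "('a, 'q) dmts"
  assumes "is_dmts D"
  shows "naa_impls (naa_of_dmts D) = dmts_impls D"
proof -
  have must_may: "(s, a, t) \<in> dmts_may D" if "(s, N) \<in> dmts_must D" "(a, t) \<in> N" for s N a t
    using assms that by (auto simp: is_dmts_def)
  have step: "(\<exists>M\<in>naa_tran (naa_of_dmts D) s.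
            (\<forall>a j. (i, a, j) \<in> T \<longrightarrow> (\<exists>t. (a, t) \<in> M \<and> (j, t) \<in> R))
          \<and> (\<forall>a t. (a, t) \<in> M \<longrightarrow> (\<exists>j. (i, a, j) \<in> T \<and> (j, t) \<in> R)))
      \<longleftrightarrow> (\<forall>a j. (i, a, j) \<in> T \<longrightarrow> (\<exists>t. (s, a, t) \<in> dmts_may D \<and> (j, t) \<in> R))
          \<and> (\<forall>N. (s, N) \<in> dmts_must D \<longrightarrow>
               (\<exists>a j t. (i, a, j) \<in> T \<and> (a, t) \<in> N \<and> (j, t) \<in> R))"
    (is "?naa \<longleftrightarrow> ?dmts") for i :: 's and s T R
  proof
    assume ?naa
    then obtain M where "M \<subseteq> {(a, t). (s, a, t) \<in> dmts_may D}"
      and ne: "\<And>N. (s, N) \<in> dmts_must D \<Longrightarrow> N \<inter> M \<noteq> {}"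
      and "\<forall>a j. (i, a, j) \<in> T \<longrightarrow> (\<exists>t. (a, t) \<in> M \<and> (j, t) \<in> R)"
      and "\<forall>a t. (a, t) \<in> M \<longrightarrow> (\<exists>j. (i, a, j) \<in> T \<and> (j, t) \<in> R)"
      by (auto simp: naa_of_dmts_def)
    \<comment> \<open>A common element of \<open>N\<close> and \<open>M\<close> is realised by a
      transition of \<open>i\<close>, which meets the must \<open>N\<close>.\<close>
    then show ?dmts
      by (fastforce dest: ne)
  next
    assume R: ?dmts
    \<comment> \<open>Only the may transitions that \<open>i\<close> realises within
      \<open>R\<close> are kept, so one matching direction is immediate. Each must still meets this
      set, since its elements are may transitions.\<close>
    let ?M = "{(a, t). (s, a, t) \<in> dmts_may D \<and> (\<exists>j. (i, a, j) \<in> T \<and> (j, t) \<in> R)}"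
    have "?M \<in> naa_tran (naa_of_dmts D) s"
      using R must_may by (fastforce simp: naa_of_dmts_def)
    then show ?naa
      by (rule rev_bexI) (use R in blast)
  qed
  have "naa_states (naa_of_dmts D) = dmts_states D" "naa_init (naa_of_dmts D) = dmts_init D"
    by (simp_all add: naa_of_dmts_def)
  then show ?thesis
    by (intro Set.set_eqI) (simp only: naa_impls_iff dmts_impls_iff step)
qed

section \<open>From acceptance automata to disjunctive modal transition systems\<close>

text \<open>The states are the acceptance sets: committing to one of them resolves the choice in the
  automaton. The parameter \<open>e\<close> encodes acceptance sets as elements of the state type.\<close>

definition dmts_of_naa :: "(('a \<times> 'q) set \<Rightarrow> 'p) \<Rightarrow> ('a, 'q) naa \<Rightarrow> ('a, 'p) dmts" where
  "dmts_of_naa e A = (let Ms = \<Union>(naa_tran A ` naa_states A) in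
     \<lparr>dmts_states = e ` Ms,
      dmts_init = e ` \<Union>(naa_tran A ` naa_init A),
      dmts_may = {(e M, a, e M') | M a t M'. M \<in> Ms \<and> (a, t) \<in> M \<and> M' \<in> naa_tran A t},
      dmts_must = {(e M, {(a, e M') | M'. M' \<in> naa_tran A t}) | M a t. M \<in> Ms \<and> (a, t) \<in> M}\<rparr>)"

lemma naa_tran_target:
  "\<lbrakk>is_naa A; s \<in> naa_states A; M \<in> naa_tran A s; (a, t) \<in> M\<rbrakk> \<Longrightarrow> t \<in> naa_states A"
  by (fastforce simp: is_naa_def Fpow_def)

context
  fixes A :: "('a, 'q) naa" and e :: "('a \<times> 'q) set \<Rightarrow> 'p"
  assumes A: "is_naa A" and e: "inj_on e (\<Union>(naa_tran A ` naa_states A))"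
begin

lemma encode_eq_iff:
  "\<lbrakk>s \<in> naa_states A; M \<in> naa_tran A s; s' \<in> naa_states A; M' \<in> naa_tran A s'\<rbrakk>
    \<Longrightarrow> e M = e M' \<longleftrightarrow> M = M'"
  using e by (auto simp: inj_on_def)

text \<open>By injectivity of \<open>e\<close> the state \<open>e M\<close> determines
  \<open>M\<close>. An acceptance set offered by several automaton states becomes one state,
  consistently so, because its transitions depend on \<open>M\<close> alone.\<close>

lemma dmts_may_dmts_of_naa_iff:
  assumes "s \<in> naa_states A" "M \<in> naa_tran A s"
  shows "(e M, a, x) \<in> dmts_may (dmts_of_naa e A)
    \<longleftrightarrow> (\<exists>t M'. (a, t) \<in> M \<and> M' \<in> naa_tran A t \<and> x = e M')"
  using assms by (auto simp: dmts_of_naa_def encode_eq_iff)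

lemma dmts_must_dmts_of_naa_iff:
  assumes "s \<in> naa_states A" "M \<in> naa_tran A s"
  shows "(e M, N) \<in> dmts_must (dmts_of_naa e A)
    \<longleftrightarrow> (\<exists>a t. (a, t) \<in> M \<and> N = {(a, e M') | M'. M' \<in> naa_tran A t})"
  using assms by (auto simp: dmts_of_naa_def encode_eq_iff) blast+

text \<open>Local finiteness enters twice: finitely many initial states offer finitely many
  acceptance sets, and so do the targets of a finite \<open>M\<close>, which gives
  image-finiteness.\<close>

lemma is_dmts_dmts_of_naa:
  assumes fin: "naa_locally_finite A"
  shows "is_dmts (dmts_of_naa e A)"
proof -
  let ?D = "dmts_of_naa e A"
  have "finite {x. (y, a, x) \<in> dmts_may ?D}" if "y \<in> dmts_states ?D" for y a
  proof -
    from that obtain s M where s: "s \<in> naa_states A" "M \<in> naa_tran A s" and y: "y = e M"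
      by (auto simp: dmts_of_naa_def)
    have "finite M"
      using A s by (auto simp: is_naa_def Fpow_def)
    moreover have "finite (naa_tran A (snd p))" if "p \<in> M" for p
      using fin naa_tran_target[OF A s, of "fst p" "snd p"] that by (simp add: naa_locally_finite_def)
    ultimately have "finite (e ` \<Union>(naa_tran A ` snd ` M))"
      by auto
    then show ?thesis
      unfolding y by (rule rev_finite_subset) (force simp: dmts_may_dmts_of_naa_iff[OF s])
  qed
  moreover have "dmts_init ?D \<subseteq> dmts_states ?D"
    using A by (auto simp: is_naa_def dmts_of_naa_def)
  moreover have "finite (dmts_init ?D)"
    using A fin by (auto simp: is_naa_def dmts_of_naa_def naa_locally_finite_def)
  moreover have "dmts_may ?D \<subseteq> dmts_states ?D \<times> UNIV \<times> dmts_states ?D"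
    and "dmts_must ?D \<subseteq> dmts_states ?D \<times> Pow (UNIV \<times> dmts_states ?D)"
    by (auto simp: dmts_of_naa_def dest: naa_tran_target[OF A])
  moreover have "(y, a, x) \<in> dmts_may ?D" if "(y, N) \<in> dmts_must ?D" "(a, x) \<in> N" for y N a x
    using that by (auto simp: dmts_of_naa_def)
  ultimately show ?thesis
    unfolding is_dmts_def image_finite_def by blast
qed

text \<open>From left to right in the automaton, \<open>i\<close> is related to the acceptance sets
  that witness the refinement step at some \<open>(i, s)\<close>. Conversely, \<open>i\<close> is
  related to every \<open>s\<close> that offers an acceptance set related to
  \<open>i\<close>.\<close>

lemma dmts_impls_dmts_of_naa: "dmts_impls (dmts_of_naa e A) = naa_impls A"
proof (intro Set.set_eqI iffI)
  fix L :: "('a, 's) lts"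
  assume "L \<in> naa_impls A"
  then obtain R where L: "is_lts L" and R: "R \<subseteq> lts_states L \<times> naa_states A"
    and init: "\<exists>s\<in>naa_init A. (lts_init L, s) \<in> R"
    and step: "\<And>i s. (i, s) \<in> R \<Longrightarrow> \<exists>M\<in>naa_tran A s.
            (\<forall>a j. (i, a, j) \<in> lts_trans L \<longrightarrow> (\<exists>t. (a, t) \<in> M \<and> (j, t) \<in> R))
          \<and> (\<forall>a t. (a, t) \<in> M \<longrightarrow> (\<exists>j. (i, a, j) \<in> lts_trans L \<and> (j, t) \<in> R))"
    by (auto simp: naa_impls_iff)
  \<comment> \<open>An acceptance set of \<open>s\<close> that \<open>i\<close> does not match must
    not be related to \<open>i\<close>; \<open>good\<close> selects the matching ones.\<close>
  define good where "good i M \<longleftrightarrow>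
      (\<forall>a j. (i, a, j) \<in> lts_trans L \<longrightarrow> (\<exists>t. (a, t) \<in> M \<and> (j, t) \<in> R))
    \<and> (\<forall>a t. (a, t) \<in> M \<longrightarrow> (\<exists>j. (i, a, j) \<in> lts_trans L \<and> (j, t) \<in> R))" for i M
  define R' where "R' = {(i, e M) | i s M. (i, s) \<in> R \<and> M \<in> naa_tran A s \<and> good i M}"
  \<comment> \<open>This lifts a successor pair \<open>(j, t)\<close> to some acceptance set of
    \<open>t\<close>, as both the may and the must condition require.\<close>
  have R'I: "\<exists>M\<in>naa_tran A s. (i, e M) \<in> R'" if "(i, s) \<in> R" for i s
    using step[OF that] that by (auto simp: R'_def good_def)
  have "(\<forall>a j. (i, a, j) \<in> lts_trans L \<longrightarrow> (\<exists>x. (y, a, x) \<in> dmts_may (dmts_of_naa e A) \<and> (j, x) \<in> R'))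
      \<and> (\<forall>N. (y, N) \<in> dmts_must (dmts_of_naa e A) \<longrightarrow>
           (\<exists>a j x. (i, a, j) \<in> lts_trans L \<and> (a, x) \<in> N \<and> (j, x) \<in> R'))"
    if "(i, y) \<in> R'" for i y
  proof -
    from that obtain s M where y: "y = e M" and M: "M \<in> naa_tran A s" and good: "good i M"
      and "(i, s) \<in> R"
      by (auto simp: R'_def)
    then have s: "s \<in> naa_states A"
      using R by auto
    show ?thesis
      unfolding y dmts_may_dmts_of_naa_iff[OF s M] dmts_must_dmts_of_naa_iff[OF s M]
    proof (intro conjI allI impI)
      fix a j assume "(i, a, j) \<in> lts_trans L"
      then obtain t where "(a, t) \<in> M" "(j, t) \<in> R"
        using good unfolding good_def by blast
      with R'I[of j t] show "\<exists>x. (\<exists>t M'. (a, t) \<in> M \<and> M' \<in> naa_tran A t \<and> x = e M') \<and> (j, x) \<in> R'"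
        by blast
    next
      fix N assume "\<exists>a t. (a, t) \<in> M \<and> N = {(a, e M') | M'. M' \<in> naa_tran A t}"
      then obtain a t where t: "(a, t) \<in> M" and N: "N = {(a, e M') | M'. M' \<in> naa_tran A t}"
        by blast
      then obtain j where "(i, a, j) \<in> lts_trans L" "(j, t) \<in> R"
        using good unfolding good_def by blast
      with R'I[of j t] show "\<exists>a j x. (i, a, j) \<in> lts_trans L \<and> (a, x) \<in> N \<and> (j, x) \<in> R'"
        unfolding N by blast
    qed
  qed
  moreover have "R' \<subseteq> lts_states L \<times> dmts_states (dmts_of_naa e A)"
    using R by (auto simp: R'_def dmts_of_naa_def)
  moreover have "\<exists>y\<in>dmts_init (dmts_of_naa e A). (lts_init L, y) \<in> R'"
  proof -
    obtain s M where "s \<in> naa_init A" "M \<in> naa_tran A s" "(lts_init L, e M) \<in> R'"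
      using init R'I by blast
    then show ?thesis
      by (auto simp: dmts_of_naa_def)
  qed
  ultimately show "L \<in> dmts_impls (dmts_of_naa e A)"
    unfolding dmts_impls_iff using L by (intro conjI exI[of _ R']) blast+
next
  fix L :: "('a, 's) lts"
  assume "L \<in> dmts_impls (dmts_of_naa e A)"
  then obtain R where L: "is_lts L" and R: "R \<subseteq> lts_states L \<times> dmts_states (dmts_of_naa e A)"
    and init: "\<exists>y\<in>dmts_init (dmts_of_naa e A). (lts_init L, y) \<in> R"
    and step: "\<forall>i y. (i, y) \<in> R \<longrightarrow>
          (\<forall>a j. (i, a, j) \<in> lts_trans L \<longrightarrow> (\<exists>x. (y, a, x) \<in> dmts_may (dmts_of_naa e A) \<and> (j, x) \<in> R))
        \<and> (\<forall>N. (y, N) \<in> dmts_must (dmts_of_naa e A) \<longrightarrow>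
             (\<exists>a j x. (i, a, j) \<in> lts_trans L \<and> (a, x) \<in> N \<and> (j, x) \<in> R))"
    unfolding dmts_impls_iff by (elim conjE exE) (rule that)
  have may: "\<exists>x. (y, a, x) \<in> dmts_may (dmts_of_naa e A) \<and> (j, x) \<in> R"
    if "(i, y) \<in> R" "(i, a, j) \<in> lts_trans L" for i y a j
    using step that by blast
  have must: "\<exists>a j x. (i, a, j) \<in> lts_trans L \<and> (a, x) \<in> N \<and> (j, x) \<in> R"
    if "(i, y) \<in> R" "(y, N) \<in> dmts_must (dmts_of_naa e A)" for i y N
    using step that by blast
  define R' where "R' = {(i, s) | i s M. s \<in> naa_states A \<and> M \<in> naa_tran A s \<and> (i, e M) \<in> R}"
  have "\<exists>M\<in>naa_tran A s.
            (\<forall>a j. (i, a, j) \<in> lts_trans L \<longrightarrow> (\<exists>t. (a, t) \<in> M \<and> (j, t) \<in> R'))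
          \<and> (\<forall>a t. (a, t) \<in> M \<longrightarrow> (\<exists>j. (i, a, j) \<in> lts_trans L \<and> (j, t) \<in> R'))"
    if "(i, s) \<in> R'" for i s
  proof -
    from that obtain M where s: "s \<in> naa_states A" and M: "M \<in> naa_tran A s" and iM: "(i, e M) \<in> R"
      by (auto simp: R'_def)
    have "\<exists>t. (a, t) \<in> M \<and> (j, t) \<in> R'" if "(i, a, j) \<in> lts_trans L" for a j
      using may[OF iM that] naa_tran_target[OF A s M]
      unfolding dmts_may_dmts_of_naa_iff[OF s M] R'_def by blast
    moreover have "\<exists>j. (i, a, j) \<in> lts_trans L \<and> (j, t) \<in> R'" if t: "(a, t) \<in> M" for a t
    proof -
      \<comment> \<open>The must for \<open>(a, t)\<close> offers exactly the acceptance sets of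
        \<open>t\<close>; whichever of them is met relates the successor to \<open>t\<close> in
        \<open>R'\<close>.\<close>
      have "(e M, {(a, e M') | M'. M' \<in> naa_tran A t}) \<in> dmts_must (dmts_of_naa e A)"
        unfolding dmts_must_dmts_of_naa_iff[OF s M] using t by blast
      from must[OF iM this] show ?thesis
        using naa_tran_target[OF A s M t] unfolding R'_def by blast
    qed
    ultimately show ?thesis
      using M by blast
  qed
  moreover have "R' \<subseteq> lts_states L \<times> naa_states A"
    using R by (auto simp: R'_def)
  moreover have "\<exists>s\<in>naa_init A. (lts_init L, s) \<in> R'"
    using init A by (auto simp: R'_def dmts_of_naa_def is_naa_def)
  ultimately show "L \<in> naa_impls A"
    unfolding naa_impls_iff using L by (intro conjI exI[of _ R']) blast+
qed

end

section \<open>Encoding finite sets of labelled targets as states\<close>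

text \<open>An infinite set has as many finite subsets as elements, and a finite alphabet as factor
  leaves its cardinality unchanged.\<close>

lemma inj_on_finite_label_sets:
  "\<exists>e :: ('a::finite \<times> 'q::infinite) set \<Rightarrow> 'q. inj_on e (Fpow UNIV)"
proof -
  have inf: "infinite (UNIV :: 'q set)"
    by (rule infinite_UNIV)
  have "|UNIV :: 'a set| \<le>o |UNIV :: 'q set|"
    using inf by (intro ordLess_imp_ordLeq finite_ordLess_infinite2) auto
  note Times = card_of_Times_infinite[OF inf _ this]
  have "infinite (UNIV :: ('a \<times> 'q) set)"
    using inf by (simp add: finite_prod)
  then have "Fpow (UNIV :: ('a \<times> 'q) set) \<approx> (UNIV :: ('a \<times> 'q) set)"
    by (rule eqpoll_Fpow)
  also have "(UNIV :: ('a \<times> 'q) set) \<approx> (UNIV :: 'q set)"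
    using Times by (simp add: eqpoll_iff_card_of_ordIso)
  finally have "Fpow (UNIV :: ('a \<times> 'q) set) \<lesssim> (UNIV :: 'q set)"
    by (rule eqpoll_imp_lepoll)
  then show ?thesis
    by (auto simp: lepoll_def)
qed

section \<open>From acceptance automata to the nu-calculus\<close>

lemma hml_sem_foldr_And:
  "hml_sem L (foldr And \<phi>s TT) \<sigma> = lts_states L \<inter> (\<Inter>\<phi>\<in>set \<phi>s. hml_sem L \<phi> \<sigma>)"
  by (induction \<phi>s) auto

lemma hml_sem_foldr_Or: "hml_sem L (foldr Or \<phi>s FF) \<sigma> = (\<Union>\<phi>\<in>set \<phi>s. hml_sem L \<phi> \<sigma>)"
  by (induction \<phi>s) auto

lemma vars_foldr_And: "vars (foldr And \<phi>s TT) = (\<Union>\<phi>\<in>set \<phi>s. vars \<phi>)"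
  by (induction \<phi>s) auto

lemma vars_foldr_Or: "vars (foldr Or \<phi>s FF) = (\<Union>\<phi>\<in>set \<phi>s. vars \<phi>)"
  by (induction \<phi>s) auto

text \<open>Semantics and variables of an iterated connective depend only on the set of its
  arguments, so an arbitrary enumeration will do.\<close>

definition list_of :: "'b set \<Rightarrow> 'b list" where
  "list_of B = (SOME xs. set xs = B)"

lemma set_list_of [simp]: "finite B \<Longrightarrow> set (list_of B) = B"
  unfolding list_of_def by (rule someI_ex) (rule finite_list)

definition Conj :: "('a, 'x) hml set \<Rightarrow> ('a, 'x) hml" where
  "Conj \<Phi> = foldr And (list_of \<Phi>) TT"

definition Disj :: "('a, 'x) hml set \<Rightarrow> ('a, 'x) hml" where
  "Disj \<Phi> = foldr Or (list_of \<Phi>) FF"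

lemma
  assumes "finite \<Phi>"
  shows hml_sem_Conj: "hml_sem L (Conj \<Phi>) \<sigma> = lts_states L \<inter> (\<Inter>\<phi>\<in>\<Phi>. hml_sem L \<phi> \<sigma>)"
    and hml_sem_Disj: "hml_sem L (Disj \<Phi>) \<sigma> = (\<Union>\<phi>\<in>\<Phi>. hml_sem L \<phi> \<sigma>)"
    and vars_Conj: "vars (Conj \<Phi>) = (\<Union>\<phi>\<in>\<Phi>. vars \<phi>)"
    and vars_Disj: "vars (Disj \<Phi>) = (\<Union>\<phi>\<in>\<Phi>. vars \<phi>)"
  using assms by (simp_all add: Conj_def Disj_def hml_sem_foldr_And hml_sem_foldr_Or
      vars_foldr_And vars_foldr_Or)

section \<open>Characteristic formulas of acceptance sets\<close>

text \<open>The diamonds demand every element of \<open>M\<close>, the boxes confine all successors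
  to \<open>M\<close>. For a label absent from \<open>M\<close> the disjunction is empty, so the box
  forbids that label. The map \<open>e\<close> turns states into variables.\<close>

definition acceptance_formula :: "('q \<Rightarrow> 'x) \<Rightarrow> ('a \<times> 'q) set \<Rightarrow> ('a, 'x) hml" where
  "acceptance_formula e M =
     And (Conj ((\<lambda>(a, t). Dia a (Var (e t))) ` M))
         (Conj (range (\<lambda>a. Box a (Disj ((\<lambda>t. Var (e t)) ` {t. (a, t) \<in> M})))))"

lemma finite_successors: "finite M \<Longrightarrow> finite {t. (a, t) \<in> M}"
  by (rule finite_subset[of _ "snd ` M"]) force+

lemma hml_sem_acceptance_formula:
  fixes M :: "('a::finite \<times> 'q) set"
  assumes "finite M"
  shows "i \<in> hml_sem L (acceptance_formula e M) \<sigma> \<longleftrightarrow> i \<in> lts_states L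
    \<and> (\<forall>a j. (i, a, j) \<in> lts_trans L \<longrightarrow> (\<exists>t. (a, t) \<in> M \<and> j \<in> \<sigma> (e t)))
    \<and> (\<forall>a t. (a, t) \<in> M \<longrightarrow> (\<exists>j. (i, a, j) \<in> lts_trans L \<and> j \<in> \<sigma> (e t)))"
  using assms by (auto simp: acceptance_formula_def hml_sem_Conj hml_sem_Disj finite_successors)

lemma vars_acceptance_formula:
  fixes M :: "('a::finite \<times> 'q) set"
  assumes "finite M"
  shows "vars (acceptance_formula e M) = e ` snd ` M"
  using assms
  by (force simp: acceptance_formula_def vars_Conj vars_Disj finite_successors)

definition nuhml_of_naa :: "('q \<Rightarrow> 'x) \<Rightarrow> ('a, 'q) naa \<Rightarrow> ('a, 'x) nuhml" where
  "nuhml_of_naa e A = \<lparr>nu_vars = e ` naa_states A, nu_init = e ` naa_init A,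
     nu_decl = (\<lambda>x. Disj (acceptance_formula e ` naa_tran A (inv_into (naa_states A) e x)))\<rparr>"

context
  fixes A :: "('a::finite, 'q) naa" and e :: "'q \<Rightarrow> 'x"
  assumes A: "is_naa A" and fin: "finite (naa_states A)" and e: "inj_on e (naa_states A)"
begin

lemma finite_tran: "s \<in> naa_states A \<Longrightarrow> finite (naa_tran A s)"
  using finite_naa_locally_finite[OF A fin] by (simp add: naa_locally_finite_def)

lemma finite_acceptance_set: "\<lbrakk>s \<in> naa_states A; M \<in> naa_tran A s\<rbrakk> \<Longrightarrow> finite M"
  using A by (auto simp: is_naa_def Fpow_def)

lemma nu_decl_nuhml_of_naa:
  "s \<in> naa_states A \<Longrightarrow>
    nu_decl (nuhml_of_naa e A) (e s) = Disj (acceptance_formula e ` naa_tran A s)"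
  using e by (simp add: nuhml_of_naa_def)

lemma is_nuhml_nuhml_of_naa: "is_nuhml (nuhml_of_naa e A)"
proof -
  have "vars (nu_decl (nuhml_of_naa e A) (e s)) \<subseteq> e ` naa_states A" if s: "s \<in> naa_states A" for s
    using naa_tran_target[OF A s]
    by (fastforce simp: nu_decl_nuhml_of_naa[OF s] vars_Disj finite_tran[OF s]
        vars_acceptance_formula finite_acceptance_set[OF s])
  then show ?thesis
    using A fin by (auto simp: is_nuhml_def is_naa_def nuhml_of_naa_def)
qed

lemma hml_sem_nu_decl_nuhml_of_naa:
  assumes s: "s \<in> naa_states A"
  shows "i \<in> hml_sem L (nu_decl (nuhml_of_naa e A) (e s)) \<sigma> \<longleftrightarrow> i \<in> lts_states L
    \<and> (\<exists>M\<in>naa_tran A s.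
        (\<forall>a j. (i, a, j) \<in> lts_trans L \<longrightarrow> (\<exists>t. (a, t) \<in> M \<and> j \<in> \<sigma> (e t)))
      \<and> (\<forall>a t. (a, t) \<in> M \<longrightarrow> (\<exists>j. (i, a, j) \<in> lts_trans L \<and> j \<in> \<sigma> (e t))))"
  using finite_acceptance_set[OF s]
  by (auto simp: nu_decl_nuhml_of_naa[OF s] hml_sem_Disj finite_tran[OF s]
      hml_sem_acceptance_formula)

text \<open>Relations and assignments are two views of one object: \<open>i\<close> lies in the
  value of \<open>e s\<close> iff \<open>(i, s)\<close> is in the relation. Under this
  correspondence the refinement step is postfixedness, so the greatest assignment yields a
  refinement and every refinement lies below it.\<close>

lemma nuhml_impls_nuhml_of_naa: "nuhml_impls (nuhml_of_naa e A) = naa_impls A"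
proof (intro Set.set_eqI iffI)
  let ?F = "nuhml_of_naa e A"
  fix L :: "('a, 's) lts"
  assume L: "L \<in> nuhml_impls ?F"
  let ?\<sigma> = "nu_sem L ?F"
  define R where "R = {(i, s). i \<in> ?\<sigma> (e s) \<and> s \<in> naa_states A}"
  have post: "nu_postfixed L ?F ?\<sigma>"
    by (rule nu_sem_greatest)
  have "\<exists>M\<in>naa_tran A s.
        (\<forall>a j. (i, a, j) \<in> lts_trans L \<longrightarrow> (\<exists>t. (a, t) \<in> M \<and> (j, t) \<in> R))
      \<and> (\<forall>a t. (a, t) \<in> M \<longrightarrow> (\<exists>j. (i, a, j) \<in> lts_trans L \<and> (j, t) \<in> R))"
    if "(i, s) \<in> R" for i s
  proof -
    have s: "s \<in> naa_states A" and i: "i \<in> ?\<sigma> (e s)"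
      using that by (auto simp: R_def)
    moreover have "e s \<in> nu_vars ?F"
      using s by (simp add: nuhml_of_naa_def)
    ultimately have "i \<in> hml_sem L (nu_decl ?F (e s)) ?\<sigma>"
      using post by (auto simp: nu_postfixed_def)
    then obtain M where M: "M \<in> naa_tran A s"
      and "\<forall>a j. (i, a, j) \<in> lts_trans L \<longrightarrow> (\<exists>t. (a, t) \<in> M \<and> j \<in> ?\<sigma> (e t))"
      and "\<forall>a t. (a, t) \<in> M \<longrightarrow> (\<exists>j. (i, a, j) \<in> lts_trans L \<and> j \<in> ?\<sigma> (e t))"
      unfolding hml_sem_nu_decl_nuhml_of_naa[OF s] by blast
    \<comment> \<open>\<open>R\<close> also demands that targets lie in the carrier, hence
      \<open>naa_tran_target\<close>.\<close>
    then show ?thesis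
      using naa_tran_target[OF A s M] unfolding R_def by (intro bexI[of _ M]) blast+
  qed
  moreover have "R \<subseteq> lts_states L \<times> naa_states A"
    using post by (auto simp: R_def nu_postfixed_def nu_assignment_def nuhml_of_naa_def)
  moreover have "\<exists>s\<in>naa_init A. (lts_init L, s) \<in> R"
    using L A by (auto simp: R_def nuhml_impls_def nuhml_of_naa_def is_naa_def)
  ultimately show "L \<in> naa_impls A"
    unfolding naa_impls_iff using L
    by (intro conjI exI[of _ R]) (simp_all add: nuhml_impls_def)
next
  let ?F = "nuhml_of_naa e A"
  fix L :: "('a, 's) lts"
  assume "L \<in> naa_impls A"
  then obtain R where L: "is_lts L" and R: "R \<subseteq> lts_states L \<times> naa_states A"
    and init: "\<exists>s\<in>naa_init A. (lts_init L, s) \<in> R"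
    and step: "\<And>i s. (i, s) \<in> R \<Longrightarrow> \<exists>M\<in>naa_tran A s.
            (\<forall>a j. (i, a, j) \<in> lts_trans L \<longrightarrow> (\<exists>t. (a, t) \<in> M \<and> (j, t) \<in> R))
          \<and> (\<forall>a t. (a, t) \<in> M \<longrightarrow> (\<exists>j. (i, a, j) \<in> lts_trans L \<and> (j, t) \<in> R))"
    by (auto simp: naa_impls_iff)
  define \<sigma> where "\<sigma> x = {i. \<exists>s. (i, s) \<in> R \<and> x = e s}" for x
  have \<sigma>_e: "i \<in> \<sigma> (e s) \<longleftrightarrow> (i, s) \<in> R" if "s \<in> naa_states A" for i s
    using that R e by (auto simp: \<sigma>_def dest: inj_onD)
  have "i \<in> hml_sem L (nu_decl ?F (e s)) \<sigma>" if s: "s \<in> naa_states A" and i: "i \<in> \<sigma> (e s)" for i s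
  proof -
    have iR: "(i, s) \<in> R"
      using i \<sigma>_e[OF s] by simp
    obtain M where M: "M \<in> naa_tran A s"
      and 1: "\<forall>a j. (i, a, j) \<in> lts_trans L \<longrightarrow> (\<exists>t. (a, t) \<in> M \<and> (j, t) \<in> R)"
      and 2: "\<forall>a t. (a, t) \<in> M \<longrightarrow> (\<exists>j. (i, a, j) \<in> lts_trans L \<and> (j, t) \<in> R)"
      using step[OF iR] by blast
    have *: "(j, t) \<in> R \<Longrightarrow> j \<in> \<sigma> (e t)" for j t
      by (auto simp: \<sigma>_def)
    show ?thesis
      unfolding hml_sem_nu_decl_nuhml_of_naa[OF s]
      using iR R M 1 2 * by (intro conjI bexI[of _ M]) blast+
  qed
  then have "nu_postfixed L ?F \<sigma>"
    using R by (auto simp: nu_postfixed_def nu_assignment_def nuhml_of_naa_def \<sigma>_def)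
  then have "\<sigma> \<le> nu_sem L ?F"
    by (rule nu_sem_greatest)
  then show "L \<in> nuhml_impls ?F"
    using L init by (auto simp: nuhml_impls_def nuhml_of_naa_def le_fun_def \<sigma>_def)
qed

end

section \<open>From the nu-calculus to acceptance automata\<close>

primrec subformulas :: "('a, 'x) hml \<Rightarrow> ('a, 'x) hml set" where
  "subformulas TT = {TT}"
| "subformulas FF = {FF}"
| "subformulas (Var x) = {Var x}"
| "subformulas (And \<phi> \<psi>) = insert (And \<phi> \<psi>) (subformulas \<phi> \<union> subformulas \<psi>)"
| "subformulas (Or \<phi> \<psi>) = insert (Or \<phi> \<psi>) (subformulas \<phi> \<union> subformulas \<psi>)"
| "subformulas (Dia a \<phi>) = insert (Dia a \<phi>) (subformulas \<phi>)"
| "subformulas (Box a \<phi>) = insert (Box a \<phi>) (subformulas \<phi>)"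

lemma finite_subformulas: "finite (subformulas \<phi>)"
  by (induction \<phi>) auto

lemma self_in_subformulas: "\<phi> \<in> subformulas \<phi>"
  by (cases \<phi>) auto

lemma subformulas_trans: "\<psi> \<in> subformulas \<phi> \<Longrightarrow> subformulas \<psi> \<subseteq> subformulas \<phi>"
  by (induction \<phi>) auto

lemma Var_in_subformulas: "Var x \<in> subformulas \<phi> \<Longrightarrow> x \<in> vars \<phi>"
  by (induction \<phi>) auto

text \<open>Variables are added separately because one that occurs in no declaration may still be
  initial.\<close>

definition nu_closure :: "('a, 'x) nuhml \<Rightarrow> ('a, 'x) hml set" where
  "nu_closure F = Var ` nu_vars F \<union> (\<Union>x\<in>nu_vars F. subformulas (nu_decl F x))"

text \<open>A variable is unfolded to its declaration with no bound on repeated unfolding, which is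
  the right reading for greatest fixed points.\<close>

definition hintikka :: "('a, 'x) nuhml \<Rightarrow> ('a, 'x) hml set \<Rightarrow> bool" where
  "hintikka F U \<longleftrightarrow> FF \<notin> U
     \<and> (\<forall>x. Var x \<in> U \<longrightarrow> nu_decl F x \<in> U)
     \<and> (\<forall>\<phi> \<psi>. And \<phi> \<psi> \<in> U \<longrightarrow> \<phi> \<in> U \<and> \<psi> \<in> U)
     \<and> (\<forall>\<phi> \<psi>. Or \<phi> \<psi> \<in> U \<longrightarrow> \<phi> \<in> U \<or> \<psi> \<in> U)"

definition hintikka_sets :: "('a, 'x) nuhml \<Rightarrow> ('a, 'x) hml set set" where
  "hintikka_sets F = {U. U \<subseteq> nu_closure F \<and> hintikka F U}"

text \<open>A state is the set of formulas that an implementation of it has to satisfy; the propositional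
  obligations are discharged by the Hintikka conditions and the modal ones by the acceptance sets.
  The parameter \<open>e\<close> encodes Hintikka sets as elements of the state type.\<close>

definition naa_of_nuhml :: "(('a, 'x) hml set \<Rightarrow> 'q) \<Rightarrow> ('a, 'x) nuhml \<Rightarrow> ('a, 'q) naa" where
  "naa_of_nuhml e F = \<lparr>naa_states = e ` hintikka_sets F,
     naa_init = e ` {U \<in> hintikka_sets F. \<exists>x\<in>nu_init F. Var x \<in> U},
     naa_tran = (\<lambda>q. let U = inv_into (hintikka_sets F) e q in
       {map_prod id e ` M | M. M \<subseteq> UNIV \<times> hintikka_sets F
         \<and> (\<forall>a \<phi>. Dia a \<phi> \<in> U \<longrightarrow> (\<exists>V. (a, V) \<in> M \<and> \<phi> \<in> V))
         \<and> (\<forall>a \<phi> V. Box a \<phi> \<in> U \<longrightarrow> (a, V) \<in> M \<longrightarrow> \<phi> \<in> V)})\<rparr>"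

context
  fixes F :: "('a::finite, 'x) nuhml"
  assumes F: "is_nuhml F"
begin

lemma finite_nu_closure: "finite (nu_closure F)"
  using F by (auto simp: nu_closure_def is_nuhml_def finite_subformulas)

lemma finite_hintikka_sets: "finite (hintikka_sets F)"
  by (rule finite_subset[of _ "Pow (nu_closure F)"]) (auto simp: hintikka_sets_def finite_nu_closure)

lemma nu_closure_subformulas:
  assumes "\<phi> \<in> nu_closure F"
  shows "subformulas \<phi> \<subseteq> nu_closure F"
  using assms subformulas_trans unfolding nu_closure_def by fastforce

lemma Var_in_nu_closure: "Var x \<in> nu_closure F \<longleftrightarrow> x \<in> nu_vars F"
  using F by (auto simp: nu_closure_def is_nuhml_def dest: Var_in_subformulas)

lemma nu_decl_in_nu_closure: "x \<in> nu_vars F \<Longrightarrow> nu_decl F x \<in> nu_closure F"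
  using self_in_subformulas by (auto simp: nu_closure_def)

lemma nu_closure_And: "And \<phi> \<psi> \<in> nu_closure F \<Longrightarrow> \<phi> \<in> nu_closure F \<and> \<psi> \<in> nu_closure F"
  using nu_closure_subformulas[of "And \<phi> \<psi>"] self_in_subformulas[of \<phi>] self_in_subformulas[of \<psi>]
  by auto

lemma nu_closure_Or: "Or \<phi> \<psi> \<in> nu_closure F \<Longrightarrow> \<phi> \<in> nu_closure F \<and> \<psi> \<in> nu_closure F"
  using nu_closure_subformulas[of "Or \<phi> \<psi>"] self_in_subformulas[of \<phi>] self_in_subformulas[of \<psi>]
  by auto

lemma nu_closure_Dia: "Dia a \<phi> \<in> nu_closure F \<Longrightarrow> \<phi> \<in> nu_closure F"
  using nu_closure_subformulas[of "Dia a \<phi>"] self_in_subformulas[of \<phi>] by auto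

lemma nu_closure_Box: "Box a \<phi> \<in> nu_closure F \<Longrightarrow> \<phi> \<in> nu_closure F"
  using nu_closure_subformulas[of "Box a \<phi>"] self_in_subformulas[of \<phi>] by auto

text \<open>Postfixedness supplies the unfolding of variables; the other conditions are the semantic
  clauses. This provides the states by which an implementation is simulated.\<close>

lemma hintikka_satisfied_formulas:
  assumes "nu_postfixed L F \<sigma>"
  shows "{\<phi> \<in> nu_closure F. i \<in> hml_sem L \<phi> \<sigma>} \<in> hintikka_sets F"
  using assms
  by (auto simp: hintikka_sets_def hintikka_def Var_in_nu_closure nu_decl_in_nu_closure
      nu_postfixed_def dest: nu_closure_And nu_closure_Or)

context
  fixes e :: "('a, 'x) hml set \<Rightarrow> 'q"
  assumes e: "inj_on e (hintikka_sets F)"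
begin

lemma naa_tran_naa_of_nuhml:
  "U \<in> hintikka_sets F \<Longrightarrow> naa_tran (naa_of_nuhml e F) (e U) =
     {map_prod id e ` M | M. M \<subseteq> UNIV \<times> hintikka_sets F
         \<and> (\<forall>a \<phi>. Dia a \<phi> \<in> U \<longrightarrow> (\<exists>V. (a, V) \<in> M \<and> \<phi> \<in> V))
         \<and> (\<forall>a \<phi> V. Box a \<phi> \<in> U \<longrightarrow> (a, V) \<in> M \<longrightarrow> \<phi> \<in> V)}"
  using e by (simp add: naa_of_nuhml_def)

lemma finite_naa_states_naa_of_nuhml: "finite (naa_states (naa_of_nuhml e F))"
  by (simp add: naa_of_nuhml_def finite_hintikka_sets)

lemma is_naa_naa_of_nuhml: "is_naa (naa_of_nuhml e F)"
proof -
  have "M' \<in> Fpow (UNIV \<times> e ` hintikka_sets F)"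
    if U: "U \<in> hintikka_sets F" and M': "M' \<in> naa_tran (naa_of_nuhml e F) (e U)" for U M'
  proof -
    obtain M where M: "M \<subseteq> UNIV \<times> hintikka_sets F" "M' = map_prod id e ` M"
      using M' unfolding naa_tran_naa_of_nuhml[OF U] by (elim CollectE exE conjE) (rule that)
    moreover have "finite M"
      using M(1) by (rule finite_subset) (simp add: finite_hintikka_sets)
    ultimately show ?thesis
      by (auto simp: Fpow_def)
  qed
  moreover have "naa_states (naa_of_nuhml e F) = e ` hintikka_sets F"
    by (simp add: naa_of_nuhml_def)
  moreover have "naa_init (naa_of_nuhml e F) \<subseteq> e ` hintikka_sets F"
    by (auto simp: naa_of_nuhml_def)
  ultimately show ?thesis
    unfolding is_naa_def
    using finite_subset[OF _ finite_imageI[OF finite_hintikka_sets]] by auto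
qed

text \<open>A model is related to the automaton by sending each state to the closure formulas it
  satisfies. Conversely, a state related to a Hintikka set satisfies all its members under an
  assignment read off from the refinement.\<close>

lemma naa_impls_naa_of_nuhml: "naa_impls (naa_of_nuhml e F) = nuhml_impls F"
proof (intro Set.set_eqI iffI)
  let ?A = "naa_of_nuhml e F"
  fix L :: "('a, 's) lts"
  assume L: "L \<in> nuhml_impls F"
  then have lts: "is_lts L"
    by (simp add: nuhml_impls_def)
  define Th where "Th i = {\<phi> \<in> nu_closure F. i \<in> hml_sem L \<phi> (nu_sem L F)}" for i
  have Th: "Th i \<in> hintikka_sets F" for i
    unfolding Th_def by (intro hintikka_satisfied_formulas nu_sem_greatest)
  define R where "R = {(i, e (Th i)) | i. i \<in> lts_states L}"
  have "\<exists>M\<in>naa_tran ?A q.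
        (\<forall>a j. (i, a, j) \<in> lts_trans L \<longrightarrow> (\<exists>t. (a, t) \<in> M \<and> (j, t) \<in> R))
      \<and> (\<forall>a t. (a, t) \<in> M \<longrightarrow> (\<exists>j. (i, a, j) \<in> lts_trans L \<and> (j, t) \<in> R))"
    if "(i, q) \<in> R" for i q
  proof -
    have q: "q = e (Th i)"
      using that by (auto simp: R_def)
    \<comment> \<open>The theories of the actual successors: a true diamond has its witness among
      them, and a true box holds in all of them.\<close>
    define M where "M = {(a, Th j) | a j. (i, a, j) \<in> lts_trans L}"
    have "\<exists>V. (a, V) \<in> M \<and> \<phi> \<in> V" if "Dia a \<phi> \<in> Th i" for a \<phi>
      using that by (auto simp: M_def Th_def dest: nu_closure_Dia)
    moreover have "\<phi> \<in> V" if "Box a \<phi> \<in> Th i" "(a, V) \<in> M" for a \<phi> V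
      using that by (auto simp: M_def Th_def dest: nu_closure_Box)
    moreover have "M \<subseteq> UNIV \<times> hintikka_sets F"
      using Th by (auto simp: M_def)
    ultimately have "map_prod id e ` M \<in> naa_tran ?A q"
      unfolding q naa_tran_naa_of_nuhml[OF Th] by blast
    moreover have "j \<in> lts_states L" if "(i, a, j) \<in> lts_trans L" for a j
      using lts that by (auto simp: is_lts_def)
    ultimately show ?thesis
      by (intro bexI[of _ "map_prod id e ` M"]) (force simp: M_def R_def)+
  qed
  moreover have "R \<subseteq> lts_states L \<times> naa_states ?A"
    using Th by (auto simp: R_def naa_of_nuhml_def)
  moreover have "\<exists>q\<in>naa_init ?A. (lts_init L, q) \<in> R"
  proof -
    obtain x where "x \<in> nu_init F" "lts_init L \<in> nu_sem L F x"
      using L by (auto simp: nuhml_impls_def)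
    moreover from this have "Var x \<in> Th (lts_init L)"
      using F by (auto simp: Th_def Var_in_nu_closure is_nuhml_def)
    ultimately show ?thesis
      using Th lts by (auto simp: naa_of_nuhml_def R_def is_lts_def)
  qed
  ultimately show "L \<in> naa_impls ?A"
    unfolding naa_impls_iff using lts by (intro conjI exI[of _ R]) blast+
next
  let ?A = "naa_of_nuhml e F"
  fix L :: "('a, 's) lts"
  assume "L \<in> naa_impls ?A"
  then obtain R where L: "is_lts L" and R: "R \<subseteq> lts_states L \<times> naa_states ?A"
    and init: "\<exists>q\<in>naa_init ?A. (lts_init L, q) \<in> R"
    and step: "\<And>i q. (i, q) \<in> R \<Longrightarrow> \<exists>M\<in>naa_tran ?A q.
            (\<forall>a j. (i, a, j) \<in> lts_trans L \<longrightarrow> (\<exists>t. (a, t) \<in> M \<and> (j, t) \<in> R))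
          \<and> (\<forall>a t. (a, t) \<in> M \<longrightarrow> (\<exists>j. (i, a, j) \<in> lts_trans L \<and> (j, t) \<in> R))"
    by (auto simp: naa_impls_iff)
  define \<sigma> where "\<sigma> x = {i. \<exists>U\<in>hintikka_sets F. (i, e U) \<in> R \<and> Var x \<in> U}" for x
  \<comment> \<open>A truth lemma; \<open>i\<close> and \<open>U\<close> are generalised because the
    modal cases pass to a successor and its Hintikka set.\<close>
  have sound: "i \<in> hml_sem L \<phi> \<sigma>" if "U \<in> hintikka_sets F" "(i, e U) \<in> R" "\<phi> \<in> U" for i U \<phi>
    using that
  proof (induction \<phi> arbitrary: i U)
    case (Dia a \<phi>)
    obtain M where M: "M \<subseteq> UNIV \<times> hintikka_sets F"
        "\<forall>a \<phi>. Dia a \<phi> \<in> U \<longrightarrow> (\<exists>V. (a, V) \<in> M \<and> \<phi> \<in> V)"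
      and match: "\<forall>a t. (a, t) \<in> map_prod id e ` M \<longrightarrow> (\<exists>j. (i, a, j) \<in> lts_trans L \<and> (j, t) \<in> R)"
      using step[OF Dia.prems(2)] unfolding naa_tran_naa_of_nuhml[OF Dia.prems(1)] by blast
    obtain V where V: "(a, V) \<in> M" "\<phi> \<in> V"
      using M(2) Dia.prems(3) by blast
    then have "(a, e V) \<in> map_prod id e ` M"
      by force
    from match[rule_format, OF this] obtain j where "(i, a, j) \<in> lts_trans L" "(j, e V) \<in> R"
      by blast
    then show ?case
      using Dia.IH[of V j] V M(1) R Dia.prems(2) by auto
  next
    case (Box a \<phi>)
    obtain M where M: "M \<subseteq> UNIV \<times> hintikka_sets F"
        "\<forall>a \<phi> V. Box a \<phi> \<in> U \<longrightarrow> (a, V) \<in> M \<longrightarrow> \<phi> \<in> V"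
      and match: "\<forall>a j. (i, a, j) \<in> lts_trans L \<longrightarrow> (\<exists>t. (a, t) \<in> map_prod id e ` M \<and> (j, t) \<in> R)"
      using step[OF Box.prems(2)] unfolding naa_tran_naa_of_nuhml[OF Box.prems(1)] by blast
    have "j \<in> hml_sem L \<phi> \<sigma>" if j: "(i, a, j) \<in> lts_trans L" for j
    proof -
      obtain V where "(a, V) \<in> M" "(j, e V) \<in> R"
        using match[rule_format, OF j] by auto
      then show ?thesis
        using Box.IH[of V j] M Box.prems(3) by auto
    qed
    then show ?case
      using R Box.prems(2) by auto
  next
    case (Or \<phi> \<psi>)
    have "\<phi> \<in> U \<or> \<psi> \<in> U"
      using Or.prems(1,3) unfolding hintikka_sets_def hintikka_def by blast
    then show ?case
      using Or.IH[OF Or.prems(1,2)] by auto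
  next
    case (And \<phi> \<psi>)
    have "\<phi> \<in> U \<and> \<psi> \<in> U"
      using And.prems(1,3) unfolding hintikka_sets_def hintikka_def by blast
    then show ?case
      using And.IH[OF And.prems(1,2)] by auto
  next
    case FF
    then show ?case
      by (simp add: hintikka_sets_def hintikka_def)
  \<comment> \<open>What remains is \<open>TT\<close>, where \<open>R\<close> keeps \<open>i\<close>
    inside the carrier, and \<open>Var\<close>, which holds by the choice of
    \<open>\<sigma>\<close>.\<close>
  qed (use R in \<open>auto simp: \<sigma>_def\<close>)
  have "nu_assignment L F \<sigma>"
    \<comment> \<open>Hintikka sets lie in the closure, which contains \<open>Var x\<close> only for
      declared \<open>x\<close>; hence \<open>\<sigma>\<close> is empty elsewhere.\<close>
    using R by (auto simp: nu_assignment_def \<sigma>_def hintikka_sets_def simp flip: Var_in_nu_closure)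
  moreover have "\<sigma> x \<subseteq> hml_sem L (nu_decl F x) \<sigma>" for x
  proof
    fix i assume "i \<in> \<sigma> x"
    then obtain U where U: "U \<in> hintikka_sets F" "(i, e U) \<in> R" "Var x \<in> U"
      by (auto simp: \<sigma>_def)
    have "nu_decl F x \<in> U"
      using U(1,3) unfolding hintikka_sets_def hintikka_def by blast
    with U(1,2) show "i \<in> hml_sem L (nu_decl F x) \<sigma>"
      by (rule sound)
  qed
  ultimately have "\<sigma> \<le> nu_sem L F"
    by (intro nu_sem_greatest) (simp add: nu_postfixed_def)
  moreover obtain x where "x \<in> nu_init F" "lts_init L \<in> \<sigma> x"
    using init by (auto simp: naa_of_nuhml_def \<sigma>_def)
  ultimately show "L \<in> nuhml_impls F"
    using L by (auto simp: nuhml_impls_def le_fun_def)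
qed

end

end

section \<open>The equivalences\<close>

text \<open>There are only finitely many Hintikka sets, so they embed into any infinite state
  type.\<close>

lemma ex_nuhml_imp_ex_naa:
  fixes F :: "('a::finite, 'x) nuhml"
  assumes "is_nuhml F"
  shows "\<exists>A :: ('a, 'q::infinite) naa.
    is_naa A \<and> finite (naa_states A) \<and> naa_impls A = (nuhml_impls F :: ('a, 's) lts set)"
proof -
  obtain e :: "('a, 'x) hml set \<Rightarrow> 'q" where "inj_on e (hintikka_sets F)"
    using arb_inj_on_finite_infinite[OF finite_hintikka_sets[OF assms]] by blast
  then show ?thesis
    using is_naa_naa_of_nuhml[OF assms] finite_naa_states_naa_of_nuhml[OF assms]
      naa_impls_naa_of_nuhml[OF assms] by blast
qed

lemma ex_naa_imp_ex_nuhml: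
  fixes A :: "('a::finite, 'q) naa"
  assumes "is_naa A" "finite (naa_states A)"
  shows "\<exists>F :: ('a, 'x::infinite) nuhml.
    is_nuhml F \<and> nuhml_impls F = (naa_impls A :: ('a, 's) lts set)"
proof -
  obtain e :: "'q \<Rightarrow> 'x" where "inj_on e (naa_states A)"
    using arb_inj_on_finite_infinite[OF assms(2)] by blast
  then show ?thesis
    using is_nuhml_nuhml_of_naa[OF assms] nuhml_impls_nuhml_of_naa[OF assms] by blast
qed

text \<open>One encoding of all finite sets serves infinite automata too, and a finite automaton
  yields finitely many acceptance sets.\<close>

lemma ex_naa_imp_ex_dmts:
  fixes A :: "('a::finite, 'q::infinite) naa"
  assumes A: "is_naa A" and fin: "naa_locally_finite A"
  shows "\<exists>D :: ('a, 'q) dmts. is_dmts D \<and> (finite (naa_states A) \<longrightarrow> finite (dmts_states D))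
    \<and> dmts_impls D = (naa_impls A :: ('a, 's) lts set)"
proof -
  obtain e :: "('a \<times> 'q) set \<Rightarrow> 'q" where "inj_on e (Fpow UNIV)"
    using inj_on_finite_label_sets by blast
  moreover have "\<Union>(naa_tran A ` naa_states A) \<subseteq> Fpow UNIV"
    using A by (auto simp: is_naa_def Fpow_def)
  ultimately have e: "inj_on e (\<Union>(naa_tran A ` naa_states A))"
    by (rule inj_on_subset)
  have "finite (naa_states A) \<longrightarrow> finite (dmts_states (dmts_of_naa e A))"
    using fin by (simp add: dmts_of_naa_def naa_locally_finite_def)
  then show ?thesis
    using is_dmts_dmts_of_naa[OF A e fin] dmts_impls_dmts_of_naa[OF A e] by blast
qed

lemma ex_dmts_imp_ex_naa:
  fixes D :: "('a::finite, 'q) dmts"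
  assumes "is_dmts D"
  shows "\<exists>A :: ('a, 'q) naa. is_naa A \<and> naa_locally_finite A
    \<and> naa_states A = dmts_states D \<and> naa_impls A = (dmts_impls D :: ('a, 's) lts set)"
  using is_naa_naa_of_dmts[OF assms] naa_locally_finite_naa_of_dmts[OF assms]
    naa_impls_naa_of_dmts[OF assms]
  by (intro exI[of _ "naa_of_dmts D"]) (simp add: naa_of_dmts_def)

theorem theorem1:
  fixes \<S> :: "('a::finite, 's) lts set"
  assumes "\<S> \<subseteq> {L. is_lts L}"
  shows
    "((\<exists>F :: ('a, 'x::infinite) nuhml. is_nuhml F \<and> nuhml_impls F = \<S>) \<longleftrightarrow>
      (\<exists>A :: ('a, 'q::infinite) naa. is_naa A \<and> finite (naa_states A) \<and> naa_impls A = \<S>))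
   \<and> ((\<exists>A :: ('a, 'q) naa. is_naa A \<and> finite (naa_states A) \<and> naa_impls A = \<S>) \<longleftrightarrow>
      (\<exists>D :: ('a, 'q) dmts. is_dmts D \<and> finite (dmts_states D) \<and> dmts_impls D = \<S>))
   \<and> ((\<exists>A :: ('a, 'q) naa. is_naa A \<and> naa_locally_finite A \<and> naa_impls A = \<S>) \<longleftrightarrow>
      (\<exists>D :: ('a, 'q) dmts. is_dmts D \<and> dmts_impls D = \<S>))"
proof (intro conjI iffI; elim exE conjE)
  fix F :: "('a, 'x) nuhml"
  assume "is_nuhml F" "nuhml_impls F = \<S>"
  then show "\<exists>A :: ('a, 'q) naa. is_naa A \<and> finite (naa_states A) \<and> naa_impls A = \<S>"
    using ex_nuhml_imp_ex_naa by blast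
next
  fix A :: "('a, 'q) naa"
  assume "is_naa A" "finite (naa_states A)" "naa_impls A = \<S>"
  then show "\<exists>F :: ('a, 'x) nuhml. is_nuhml F \<and> nuhml_impls F = \<S>"
    using ex_naa_imp_ex_nuhml by blast
next
  fix A :: "('a, 'q) naa"
  assume "is_naa A" "finite (naa_states A)" "naa_impls A = \<S>"
  then show "\<exists>D :: ('a, 'q) dmts. is_dmts D \<and> finite (dmts_states D) \<and> dmts_impls D = \<S>"
    using ex_naa_imp_ex_dmts finite_naa_locally_finite by blast
next
  fix D :: "('a, 'q) dmts"
  assume "is_dmts D" "finite (dmts_states D)" "dmts_impls D = \<S>"
  then show "\<exists>A :: ('a, 'q) naa. is_naa A \<and> finite (naa_states A) \<and> naa_impls A = \<S>"
    using ex_dmts_imp_ex_naa[of D] by auto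
next
  fix A :: "('a, 'q) naa"
  assume "is_naa A" "naa_locally_finite A" "naa_impls A = \<S>"
  then show "\<exists>D :: ('a, 'q) dmts. is_dmts D \<and> dmts_impls D = \<S>"
    using ex_naa_imp_ex_dmts by blast
next
  fix D :: "('a, 'q) dmts"
  assume "is_dmts D" "dmts_impls D = \<S>"
  then show "\<exists>A :: ('a, 'q) naa. is_naa A \<and> naa_locally_finite A \<and> naa_impls A = \<S>"
    using ex_dmts_imp_ex_naa[of D] by auto
qed

end
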